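(* Let $n=m=M=1$. Suppose $R_{xr}^{N-}\ne 0$ and that there exists $(R_{xr}^{N-})^\dagger\in\mathbb{R}$ such that $R_{xr}^{N-}(R_{xr}^{N-})^\dagger=1$ and both $$(R_{xr}^{N+}-c^l)(R_{xr}^{N-})^\dagger\quad\text{and}\quad(R_{xr}^{N+}-c^u)(R_{xr}^{N-})^\dagger$$ are stable. Then the data $(U_-,X)$ are informative for stabilization by state feedback. Moreover, $K=R_{ur}^{N-}(R_{xr}^{N-})^\dagger$, with $(R_{xr}^{N-})^\dagger$ as just described, satisfies $\Sigma_{(U_-,X)}^R\subseteq\Sigma_K$.
   Context: Scalar setting with one instrumental signal. Let $N\ge1$. State data $x(0),\dots,x(N)\in\mathbb{R}$ and input data $u(0),\dots,u(N-1)\in\mathbb{R}$ are collected in $X=[x(0)\ \cdots\ x(N)]$, $X_+=[x(1)\ \cdots\ x(N)]$, $X_-=[x(0)\ \cdots\ x(N-1)]$, $U_-=[u(0)\ \cdots\ u(N-1)]$. An instrumental signal $R_-=[r(0)\ \cdots\ r(N-1)]\in\mathbb{R}^{1\times N}$ and bounds $c^l,c^u\in\mathbb{R}$ are given. The data are generated by a true system $(A_0,B_0)\in\mathbb{R}^2$, i.e. $X_+=A_0X_-+B_0U_-+E_-^0$ for some unknown noise $E_-^0\in\mathcal{E}_R:=\{E\in\mathbb{R}^{1\times N}\mid c^l\le\frac{1}{\sqrt N}ER_-^\top\le c^u\}$. The set of feasible systems is $$\Sigma_{(U_-,X)}^R:=\{(A,B)\in\mathbb{R}^2\mid\exists E_-\in\mathcal{E}_R:\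 X_+=AX_-+BU_-+E_-\}.$$ Define $R_{xr}^{N+}=\frac1{\sqrt N}X_+R_-^\top$, $R_{xr}^{N-}=\frac1{\sqrt N}X_-R_-^\top$, $R_{ur}^{N-}=\frac1{\sqrt N}U_-R_-^\top$ (all scalars). A matrix is called stable if all its eigenvalues are in the open unit disk (for a real scalar: absolute value less than $1$). For $K\in\mathbb{R}$, $\Sigma_K:=\{(A,B)\in\mathbb{R}^2\mid A+BK\text{ is stable}\}$. The data $(U_-,X)$ are informative for stabilization by state feedback if there exists $K$ with $\Sigma_{(U_-,X)}^R\subseteq\Sigma_K$. *)

theory Defs
  imports Complex_Main
begin

(* A row vector in R^(1 x N) is a function on nat of which only the entries k < N are used
   (N + 1 entries for the state data x).  The columns of X_- are x 0, ..., x (N - 1), so X_- is x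
   itself; the columns of X_+ are x 1, ..., x N. *)

definition shift :: "(nat \<Rightarrow> real) \<Rightarrow> nat \<Rightarrow> real" where
  "shift x = (\<lambda>k. x (Suc k))"

(* (1 / sqrt N) V R_-^T, a scalar *)
definition cross_cov :: "nat \<Rightarrow> (nat \<Rightarrow> real) \<Rightarrow> (nat \<Rightarrow> real) \<Rightarrow> real" where
  "cross_cov N v r = 1 / sqrt (real N) * (\<Sum>k<N. v k * r k)"

definition noise_set :: "nat \<Rightarrow> (nat \<Rightarrow> real) \<Rightarrow> real \<Rightarrow> real \<Rightarrow> (nat \<Rightarrow> real) set" where
  "noise_set N r cl cu = {E. cl \<le> cross_cov N E r \<and> cross_cov N E r \<le> cu}"

(* X_+ = A X_- + B U_- + E *)
definition data_equation ::
  "nat \<Rightarrow> (nat \<Rightarrow> real) \<Rightarrow> (nat \<Rightarrow> real) \<Rightarrow> real \<Rightarrow> real \<Rightarrow> (nat \<Rightarrow> real) \<Rightarrow> bool" where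
  "data_equation N u x A B E \<longleftrightarrow> (\<forall>k<N. shift x k = A * x k + B * u k + E k)"

definition feasible_systems ::
  "nat \<Rightarrow> (nat \<Rightarrow> real) \<Rightarrow> (nat \<Rightarrow> real) \<Rightarrow> (nat \<Rightarrow> real) \<Rightarrow> real \<Rightarrow> real \<Rightarrow> (real \<times> real) set" where
  "feasible_systems N u x r cl cu =
     {(A, B). \<exists>E \<in> noise_set N r cl cu. data_equation N u x A B E}"

(* A scalar is a 1 x 1 matrix whose only eigenvalue is itself. *)
definition stable :: "real \<Rightarrow> bool" where
  "stable a \<longleftrightarrow> \<bar>a\<bar> < 1"

definition stabilized_systems :: "real \<Rightarrow> (real \<times> real) set" where
  "stabilized_systems K = {(A, B). stable (A + B * K)}"

definition informative_for_stabilization ::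
  "nat \<Rightarrow> (nat \<Rightarrow> real) \<Rightarrow> (nat \<Rightarrow> real) \<Rightarrow> (nat \<Rightarrow> real) \<Rightarrow> real \<Rightarrow> real \<Rightarrow> bool" where
  "informative_for_stabilization N u x r cl cu \<longleftrightarrow>
     (\<exists>K. feasible_systems N u x r cl cu \<subseteq> stabilized_systems K)"

(* G is a right inverse of R_xr^(N-) making both endpoint matrices stable. *)
definition stabilizing_inverse ::
  "nat \<Rightarrow> (nat \<Rightarrow> real) \<Rightarrow> (nat \<Rightarrow> real) \<Rightarrow> real \<Rightarrow> real \<Rightarrow> real \<Rightarrow> bool" where
  "stabilizing_inverse N x r cl cu G \<longleftrightarrow>
     cross_cov N x r * G = 1 \<and>
     stable ((cross_cov N (shift x) r - cl) * G) \<and>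
     stable ((cross_cov N (shift x) r - cu) * G)"

end

theory Submission
  imports Defs
begin

text \<open>
  Correlating the data equation with the instrumental signal replaces the unknown noise
  sequence by one unknown scalar. If \<open>(A, B)\<close> explains the data with noise \<open>E\<close>, then
  \<open>A R\<^sub>x + B R\<^sub>u = R\<^sub>+ - e\<close>, where \<open>R\<^sub>+\<close>, \<open>R\<^sub>x\<close>, \<open>R\<^sub>u\<close> and \<open>e \<in> [c\<^sup>l, c\<^sup>u]\<close> are the
  correlations of the shifted state, the state, the input and \<open>E\<close> with the instrument
  (lemma \<open>cross_cov_data_equation\<close>). For \<open>G\<close> with \<open>R\<^sub>x G = 1\<close> and the gain \<open>K = R\<^sub>u G\<close>,
  multiplying by \<open>G\<close> turns the left-hand side into the closed loop \<open>A + B K\<close>, so every feasible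
  closed loop is a value of the affine function \<open>e \<mapsto> (R\<^sub>+ - e) G\<close> on the interval
  \<open>[c\<^sup>l, c\<^sup>u]\<close>. Scalar stability is membership in the convex set \<open>(-1, 1)\<close>, hence stability
  at the two endpoints gives it on the whole interval (lemma \<open>stable_affine_between\<close>).
\<close>

lemma cross_cov_data_equation:
  assumes "data_equation N u x A B E"
  shows "cross_cov N (shift x) r = A * cross_cov N x r + B * cross_cov N u r + cross_cov N E r"
proof -
  have "(\<Sum>k<N. shift x k * r k) = (\<Sum>k<N. A * (x k * r k) + B * (u k * r k) + E k * r k)"
    using assms by (intro sum.cong) (auto simp: data_equation_def algebra_simps)
  also have "\<dots> = A * (\<Sum>k<N. x k * r k) + B * (\<Sum>k<N. u k * r k) + (\<Sum>k<N. E k * r k)"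
    by (simp add: sum.distrib sum_distrib_left)
  finally show ?thesis
    by (simp add: cross_cov_def algebra_simps add_divide_distrib)
qed

text \<open>
  The value at \<open>e\<close> lies between the two endpoint values, in an order that depends on the sign
  of \<open>G\<close>. This is where the scalar case is special: Schur stable matrices of larger size do not
  form a convex set.
\<close>

lemma stable_affine_between:
  assumes "stable ((p - l) * G)" "stable ((p - h) * G)" "l \<le> e" "e \<le> h"
  shows "stable ((p - e) * G)"
proof (cases "G \<ge> 0")
  case True
  then have "(p - h) * G \<le> (p - e) * G" "(p - e) * G \<le> (p - l) * G"
    using assms(3,4) by (auto intro: mult_right_mono)
  then show ?thesis using assms(1,2) by (auto simp: stable_def)
next
  case False
  then have "(p - l) * G \<le> (p - e) * G" "(p - e) * G \<le> (p - h) * G"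
    using assms(3,4) by (auto intro: mult_right_mono_neg)
  then show ?thesis using assms(1,2) by (auto simp: stable_def)
qed

lemma feasible_systems_stabilized:
  assumes "stabilizing_inverse N x r cl cu G"
  shows "feasible_systems N u x r cl cu \<subseteq> stabilized_systems (cross_cov N u r * G)"
proof clarify
  fix A B assume "(A, B) \<in> feasible_systems N u x r cl cu"
  then obtain E where noise: "cl \<le> cross_cov N E r" "cross_cov N E r \<le> cu"
    and data: "data_equation N u x A B E"
    by (auto simp: feasible_systems_def noise_set_def)
  have inv: "cross_cov N x r * G = 1"
    using assms by (simp add: stabilizing_inverse_def)
  have "A + B * (cross_cov N u r * G) = A * (cross_cov N x r * G) + B * (cross_cov N u r * G)"
    by (simp add: inv)
  also have "\<dots> = (cross_cov N (shift x) r - cross_cov N E r) * G"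
    by (simp add: cross_cov_data_equation[OF data] algebra_simps)
  finally have closed_loop:
    "A + B * (cross_cov N u r * G) = (cross_cov N (shift x) r - cross_cov N E r) * G" .
  have "stable ((cross_cov N (shift x) r - cross_cov N E r) * G)"
    using assms noise by (auto simp: stabilizing_inverse_def intro: stable_affine_between)
  then show "(A, B) \<in> stabilized_systems (cross_cov N u r * G)"
    by (simp add: stabilized_systems_def closed_loop)
qed

theorem proposition8:
  fixes N :: nat and x u r :: "nat \<Rightarrow> real" and cl cu A0 B0 :: real
  assumes "N \<ge> 1"
    and "\<exists>E0 \<in> noise_set N r cl cu. data_equation N u x A0 B0 E0"
    and "cross_cov N x r \<noteq> 0"
    and "\<exists>G. stabilizing_inverse N x r cl cu G"
  shows "informative_for_stabilization N u x r cl cu \<and>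
    (\<forall>G. stabilizing_inverse N x r cl cu G \<longrightarrow>
       feasible_systems N u x r cl cu \<subseteq> stabilized_systems (cross_cov N u r * G))"
  using assms(4) feasible_systems_stabilized
  unfolding informative_for_stabilization_def by blast

end
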